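(* Let $V_1$ be the optimal value of the linear relaxation of the extended arc-path formulation (AP) of a dynamic unsplittable flow instance, and let $V_2$ be the optimal value of the linear relaxation of the path-sequence formulation (PS) of the same instance (both formulations are given in the context). Then $V_1 = V_2$.
   Context: **Instance.** $T=\{0,1,\dots,\tau\}$ is a finite set of time steps, where time step $0$ carries the imposed initial paths. $G=(V,E,(E_t)_{t\in T})$ is a finite directed or undirected dynamic graph: $V$ is the set of nodes, $E$ the set of arcs, and $E_t\subseteq E$ the set of arcs allowed at time step $t$. Each arc $e\in E_t$ has a capacity $c_{et}\ge 0$ at time step $t$. $K$ is a finite set of commodities; commodity $k$ has a demand $d^k\ge 0$ and, at each time step $t$, an origin $O^k_t\in V$ and a destination $D^k_t\in V$. For $t\ge 1$, $P^k_t$ is the finite set of all (simple) paths usable by commodity $k$ at time step $t$, i.e. paths from $O^k_t$ to $D^k_t$ using arcs of $E_t$. The set $P^k_0$ contains exactly one path, the initial path of commodity $k$. A path may belong to $P^k_t$ for several values of $t$. The number $\alpha>0$ is the price of a path change, and $B\ge 0$ is the amount of overflow that is not penalized at each time step. **Extended arc-path formulation (AP).** The variables are $x^k_{pt}$ and $n^k_{pt}$ (for $k\in K$, $t\in T$, $p\in P^k_t$), $o_{et}$ (for $t\in T$, $e\in E_t$), and $o_t$ (for $t\in T$). By convention $x^k_{pt}=0$ if $p\notin P^k_t$. $$\min\ \alpha\sum_{k\in K}\sum_{t\in T}\sum_{p\in P^k_t} n^k_{pt}+\sum_{t\in T}o_t$$ subject to - $\sum_{p\in P^k_t}x^k_{pt}=1$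 for all $k\in K$, $t\in T$; - $\sum_{k\in K}\sum_{p\in P^k_t:\, e\in p}x^k_{pt}d^k\le c_{et}+o_{et}$ for all $t\in T$, $e\in E_t$; - $\sum_{e\in E_t}o_{et}\le B+o_t$ for all $t\in T$; - $x^k_{pt}-x^k_{p,t-1}\le n^k_{pt}$ for all $k\in K$, $t\in T\setminus\{0\}$, $p\in P^k_t$; - $x^k_{pt}\in\{0,1\}$, and $n^k_{pt},\,o_{et},\,o_t\ge 0$. **Path-sequence formulation (PS).** A path-sequence of commodity $k$ is a tuple $s=(p_t)_{t\in T}$ with $p_t\in P^k_t$ for every $t\in T$. $S^k$ is the set of all path-sequences of commodity $k$. For $t\in T$ and $e\in E_t$, $S^k_{et}$ is the set of those $s\in S^k$ whose path $p_t$ at time step $t$ uses the arc $e$. The number of path changes of $s$ is $n^k_s=|\{t\in T\setminus\{0\}: p_t\neq p_{t-1}\}|$. The variables are $x^k_s$ (for $k\in K$, $s\in S^k$), $o_{et}$ (for $t\in T$, $e\in E_t$), and $o_t$ (for $t\in T$). $$\min\ \alpha\sum_{k\in K}\sum_{s\in S^k}n^k_s\,x^k_s+\sum_{t\in T}o_t$$ subject to - $\sum_{s\in S^k}x^k_s=1$ for all $k\in K$; - $\sum_{k\in K}\sum_{s\in S^k_{et}}x^k_s d^k\le c_{et}+o_{et}$ for all $t\in T$, $e\in E_t$; - $\sum_{e\in E_t}o_{et}\le B+o_t$ for all $t\in T$; - $x^k_s\in\{0,1\}$, and $o_{et},\,o_t\ge 0$. **Linear relaxation.** The linear relaxation of each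 formulation is obtained by replacing the constraints $x^k_{pt}\in\{0,1\}$ (respectively $x^k_s\in\{0,1\}$) by $x^k_{pt}\in[0,1]$ (respectively $x^k_s\in[0,1]$). The value of an infeasible minimization problem is $+\infty$. *)

theory Defs
  imports
    "HOL-Library.Extended_Real"
    "HOL-Library.FuncSet"
    "Graph_Theory.Arc_Walk"
begin

text \<open>
  The network is a \<open>pre_digraph\<close> carrying the nodes, the arcs and the two ends of each arc. If
  \<open>is_directed\<close> is false, the arcs are read as undirected edges and their tail/head assignment is
  only an arbitrary reference orientation. Parallel arcs are allowed.
\<close>

record ('v, 'e, 'k) flow_instance =
  horizon :: nat
  is_directed :: bool
  network :: "('v, 'e) pre_digraph"
  arcs_at :: "nat \<Rightarrow> 'e set"
  capacity :: "'e \<Rightarrow> nat \<Rightarrow> real"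
  commodities :: "'k set"
  demand :: "'k \<Rightarrow> real"
  origin :: "'k \<Rightarrow> nat \<Rightarrow> 'v"
  destination :: "'k \<Rightarrow> nat \<Rightarrow> 'v"
  initial_path :: "'k \<Rightarrow> 'v \<times> ('e \<times> bool) list"
  change_price :: real
  free_overflow :: real

definition time_steps :: "('v, 'e, 'k) flow_instance \<Rightarrow> nat set" where
  "time_steps I = {0..horizon I}"

text \<open>
  A traversal \<open>(e, r)\<close> runs through the arc \<open>e\<close> from tail to head, or backwards if \<open>r\<close> holds;
  backward traversals exist only in undirected networks. Both traversals of an undirected edge
  are uses of that same edge, so they share its capacity. The paths of the (directed or undirected)
  network along arcs of \<open>A\<close> are the paths of the following digraph of traversals.
\<close>

definition traversals ::
  "('v, 'e, 'k) flow_instance \<Rightarrow> 'e set \<Rightarrow> ('v, 'e \<times> bool) pre_digraph" where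
  "traversals I A =
    \<lparr> verts = verts (network I),
      arcs = {(e, r). e \<in> A \<and> (is_directed I \<longrightarrow> \<not> r)},
      tail = (\<lambda>(e, r). if r then head (network I) e else tail (network I) e),
      head = (\<lambda>(e, r). if r then tail (network I) e else head (network I) e) \<rparr>"

text \<open>
  A path is recorded with its first node, so that trivial paths at different nodes are different.
\<close>

type_synonym ('v, 'e) path = "'v \<times> ('e \<times> bool) list"

definition simple_flow_path ::
  "('v, 'e, 'k) flow_instance \<Rightarrow> 'e set \<Rightarrow> 'v \<Rightarrow> ('v, 'e) path \<Rightarrow> 'v \<Rightarrow> bool" where
  "simple_flow_path I A u p v \<longleftrightarrow> fst p = u \<and> pre_digraph.apath (traversals I A) u (snd p) v"

definition path_arcs :: "('v, 'e) path \<Rightarrow> 'e set" where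
  "path_arcs p = fst ` set (snd p)"

definition paths :: "('v, 'e, 'k) flow_instance \<Rightarrow> 'k \<Rightarrow> nat \<Rightarrow> ('v, 'e) path set" where
  "paths I k t =
    (if t = 0 then {initial_path I k}
     else {p. simple_flow_path I (arcs_at I t) (origin I k t) p (destination I k t)})"

text \<open>
  The initial path is not required to join the origin and destination of time step 0, nor to stay
  within the arcs allowed at time step 0.
\<close>

definition valid_instance :: "('v, 'e, 'k) flow_instance \<Rightarrow> bool" where
  "valid_instance I \<longleftrightarrow>
     fin_digraph (network I) \<and>
     (\<forall>t\<in>time_steps I. arcs_at I t \<subseteq> arcs (network I)) \<and>
     (\<forall>t\<in>time_steps I. \<forall>e\<in>arcs_at I t. 0 \<le> capacity I e t) \<and>
     finite (commodities I) \<and>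
     (\<forall>k\<in>commodities I.
        0 \<le> demand I k \<and>
        (\<forall>t\<in>time_steps I. origin I k t \<in> verts (network I) \<and> destination I k t \<in> verts (network I)) \<and>
        (\<exists>u v. simple_flow_path I (arcs (network I)) u (initial_path I k) v)) \<and>
     0 < change_price I \<and>
     0 \<le> free_overflow I"


subsection \<open>Extended arc-path formulation\<close>

text \<open>
  In both formulations \<open>X\<close> is the domain of the path (sequence) variables: \<open>{0, 1}\<close> gives the
  integer program and \<open>{0..1}\<close> its linear relaxation. The infimum over an empty feasible set is
  \<open>\<infinity>\<close>.
\<close>

definition ap_feasible ::
  "('v, 'e, 'k) flow_instance \<Rightarrow> real set \<Rightarrow>
   ('k \<Rightarrow> ('v, 'e) path \<Rightarrow> nat \<Rightarrow> real) \<Rightarrow> ('k \<Rightarrow> ('v, 'e) path \<Rightarrow> nat \<Rightarrow> real) \<Rightarrow>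
   ('e \<Rightarrow> nat \<Rightarrow> real) \<Rightarrow> (nat \<Rightarrow> real) \<Rightarrow> bool" where
  "ap_feasible I X x n oe ot \<longleftrightarrow>
     (\<forall>k\<in>commodities I. \<forall>t\<in>time_steps I. (\<Sum>p\<in>paths I k t. x k p t) = 1) \<and>
     (\<forall>t\<in>time_steps I. \<forall>e\<in>arcs_at I t.
        (\<Sum>k\<in>commodities I. \<Sum>p\<in>{p \<in> paths I k t. e \<in> path_arcs p}. x k p t * demand I k)
          \<le> capacity I e t + oe e t) \<and>
     (\<forall>t\<in>time_steps I. (\<Sum>e\<in>arcs_at I t. oe e t) \<le> free_overflow I + ot t) \<and>
     (\<forall>k\<in>commodities I. \<forall>t\<in>time_steps I - {0}. \<forall>p\<in>paths I k t. x k p t - x k p (t - 1) \<le> n k p t) \<and>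
     (\<forall>k\<in>commodities I. \<forall>t\<in>time_steps I. \<forall>p\<in>paths I k t. x k p t \<in> X) \<and>
     (\<forall>k\<in>commodities I. \<forall>t\<in>time_steps I. \<forall>p. p \<notin> paths I k t \<longrightarrow> x k p t = 0) \<and>
     (\<forall>k\<in>commodities I. \<forall>t\<in>time_steps I. \<forall>p\<in>paths I k t. 0 \<le> n k p t) \<and>
     (\<forall>t\<in>time_steps I. \<forall>e\<in>arcs_at I t. 0 \<le> oe e t) \<and>
     (\<forall>t\<in>time_steps I. 0 \<le> ot t)"

definition ap_objective ::
  "('v, 'e, 'k) flow_instance \<Rightarrow> ('k \<Rightarrow> ('v, 'e) path \<Rightarrow> nat \<Rightarrow> real) \<Rightarrow> (nat \<Rightarrow> real) \<Rightarrow> real" where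
  "ap_objective I n ot =
     change_price I * (\<Sum>k\<in>commodities I. \<Sum>t\<in>time_steps I. \<Sum>p\<in>paths I k t. n k p t)
       + (\<Sum>t\<in>time_steps I. ot t)"

definition ap_value :: "('v, 'e, 'k) flow_instance \<Rightarrow> real set \<Rightarrow> ereal" where
  "ap_value I X = Inf {ereal (ap_objective I n ot) | x n oe ot. ap_feasible I X x n oe ot}"


subsection \<open>Path-sequence formulation\<close>

definition path_sequences ::
  "('v, 'e, 'k) flow_instance \<Rightarrow> 'k \<Rightarrow> (nat \<Rightarrow> ('v, 'e) path) set" where
  "path_sequences I k = (\<Pi>\<^sub>E t\<in>time_steps I. paths I k t)"

definition path_changes ::
  "('v, 'e, 'k) flow_instance \<Rightarrow> (nat \<Rightarrow> ('v, 'e) path) \<Rightarrow> nat" where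
  "path_changes I s = card {t \<in> time_steps I - {0}. s t \<noteq> s (t - 1)}"

definition ps_feasible ::
  "('v, 'e, 'k) flow_instance \<Rightarrow> real set \<Rightarrow>
   ('k \<Rightarrow> (nat \<Rightarrow> ('v, 'e) path) \<Rightarrow> real) \<Rightarrow> ('e \<Rightarrow> nat \<Rightarrow> real) \<Rightarrow> (nat \<Rightarrow> real) \<Rightarrow> bool" where
  "ps_feasible I X x oe ot \<longleftrightarrow>
     (\<forall>k\<in>commodities I. (\<Sum>s\<in>path_sequences I k. x k s) = 1) \<and>
     (\<forall>t\<in>time_steps I. \<forall>e\<in>arcs_at I t.
        (\<Sum>k\<in>commodities I. \<Sum>s\<in>{s \<in> path_sequences I k. e \<in> path_arcs (s t)}. x k s * demand I k)
          \<le> capacity I e t + oe e t) \<and>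
     (\<forall>t\<in>time_steps I. (\<Sum>e\<in>arcs_at I t. oe e t) \<le> free_overflow I + ot t) \<and>
     (\<forall>k\<in>commodities I. \<forall>s\<in>path_sequences I k. x k s \<in> X) \<and>
     (\<forall>t\<in>time_steps I. \<forall>e\<in>arcs_at I t. 0 \<le> oe e t) \<and>
     (\<forall>t\<in>time_steps I. 0 \<le> ot t)"

definition ps_objective ::
  "('v, 'e, 'k) flow_instance \<Rightarrow> ('k \<Rightarrow> (nat \<Rightarrow> ('v, 'e) path) \<Rightarrow> real) \<Rightarrow> (nat \<Rightarrow> real) \<Rightarrow> real" where
  "ps_objective I x ot =
     change_price I * (\<Sum>k\<in>commodities I. \<Sum>s\<in>path_sequences I k. real (path_changes I s) * x k s)
       + (\<Sum>t\<in>time_steps I. ot t)"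

definition ps_value :: "('v, 'e, 'k) flow_instance \<Rightarrow> real set \<Rightarrow> ereal" where
  "ps_value I X = Inf {ereal (ps_objective I x ot) | x oe ot. ps_feasible I X x oe ot}"

end

theory Submission
  imports Defs
begin

text \<open>
  Both formulations have the same overflow variables and differ only in how they describe the
  routing of a commodity: (AP) gives, for each time step, a distribution on the paths usable then,
  while (PS) gives one joint distribution on whole path-sequences. The marginals of a (PS)
  distribution carry the same flow on every arc, and their price in (AP) is no larger, since
  \<open>x\<^sub>p\<^sub>,\<^sub>t - x\<^sub>p\<^sub>,\<^sub>t\<^sub>-\<^sub>1\<close> is at most the weight of the sequences that switch to \<open>p\<close> at time \<open>t\<close>
  (lemma \<open>ap_solution_of_ps_solution\<close>).

  Conversely, given the distributions of an (AP) solution, a joint distribution with these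
  marginals is needed that changes paths no more often than (AP) pays for. Between two consecutive
  time steps such a joint distribution is a maximal coupling: everything that can stay where it is
  stays, and only the mass \<open>\<Sum>\<^sub>p max 0 (x\<^sub>p\<^sub>,\<^sub>t - x\<^sub>p\<^sub>,\<^sub>t\<^sub>-\<^sub>1)\<close> moves (lemma \<open>maximal_coupling_kernel\<close>). Chaining
  the transition kernels of these couplings as a Markov chain keeps all marginals and adds up the
  expected numbers of changes (lemma \<open>markov_chain_weights\<close>), which yields
  \<open>ps_solution_of_ap_solution\<close>.
\<close>

section \<open>Coupling consecutive distributions\<close>

text \<open>
  At each point \<open>q\<close> the share \<open>min (\<mu> q) (\<nu> q)\<close> stays put, and the surplus is redistributed according to
  the normalised deficit \<open>max 0 (\<nu> p - \<mu> p) / D\<close>, where \<open>D\<close> is the total deficit and, as both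
  total masses are 1, also the total surplus. So at most \<open>D\<close> moves. A kernel is used rather than
  a joint distribution because it can be appended to any history ending in \<open>q\<close>.
\<close>

lemma maximal_coupling_kernel:
  fixes \<mu> \<nu> :: "'p \<Rightarrow> real"
  assumes fin: "finite A" "finite B"
    and nonneg: "\<And>p. 0 \<le> \<mu> p" "\<And>p. 0 \<le> \<nu> p"
    and supp: "\<And>p. p \<notin> A \<Longrightarrow> \<mu> p = 0" "\<And>p. p \<notin> B \<Longrightarrow> \<nu> p = 0"
    and total: "sum \<mu> A = 1" "sum \<nu> B = 1"
  obtains K where "\<And>q p. 0 \<le> K q p"
    and "\<And>q. (\<Sum>p\<in>B. K q p) = 1"
    and "\<And>p. p \<in> B \<Longrightarrow> (\<Sum>q\<in>A. \<mu> q * K q p) = \<nu> p"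
    and "(\<Sum>q\<in>A. \<mu> q * (\<Sum>p\<in>B. K q p * of_bool (p \<noteq> q))) \<le> (\<Sum>p\<in>B. max 0 (\<nu> p - \<mu> p))"
proof -
  define m where "m p = min (\<mu> p) (\<nu> p)" for p
  define D where "D = (\<Sum>p\<in>B. max 0 (\<nu> p - \<mu> p))"
  \<comment> \<open>If \<open>D = 0\<close>, nothing moves, but the kernel rows still need to sum to 1; any distribution
    on \<open>B\<close> will do.\<close>
  define w where "w p = (if D = 0 then \<nu> p else max 0 (\<nu> p - \<mu> p) / D)" for p
  define r where "r q = m q / \<mu> q" for q
  define K where "K q p = (if p = q then r q else 0) + (1 - r q) * w p" for q p
  have m: "0 \<le> m p" "m p \<le> \<mu> p" "m p \<le> \<nu> p" "\<mu> p * r p = m p" for p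
    using nonneg[of p] by (auto simp: m_def r_def)
  have r01: "0 \<le> r q" "r q \<le> 1" for q
    using m[of q] nonneg[of q] by (auto simp: r_def divide_le_eq_1)
  have D_nonneg: "0 \<le> D" by (simp add: D_def sum_nonneg)
  have w_nonneg: "0 \<le> w p" for p
    using nonneg D_nonneg by (simp add: w_def)
  have w_sum: "sum w B = 1"
    using total
    by (cases "D = 0") (simp_all add: w_def D_def[symmetric] flip: sum_divide_distrib)
  have m_outside: "m p = 0" if "p \<notin> A \<or> p \<notin> B" for p
    using that supp nonneg[of p] by (auto simp: m_def)
  have m_sum: "sum m A = sum m B"
    using fin m_outside by (intro sum.mono_neutral_cong) auto
  have D_deficit: "D = 1 - sum m B"
  proof -
    have "max 0 (\<nu> p - \<mu> p) = \<nu> p - m p" for p by (simp add: m_def)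
    then show ?thesis using total by (simp add: D_def sum_subtractf)
  qed
  then have surplus: "(\<Sum>q\<in>A. \<mu> q - m q) = D"
    using total m_sum by (simp add: sum_subtractf)
  have Dw: "D * w p = \<nu> p - m p" if "p \<in> B" for p
  proof (cases "D = 0")
    case True
    then have "max 0 (\<nu> p - \<mu> p) = 0"
      using that fin sum_nonneg_eq_0_iff[of B "\<lambda>p. max 0 (\<nu> p - \<mu> p)"] by (simp add: D_def)
    then show ?thesis using True by (simp add: m_def)
  next
    case False
    then show ?thesis by (simp add: w_def m_def)
  qed
  have mass: "\<mu> q * K q p = (if p = q then m q else 0) + (\<mu> q - m q) * w p" for q p
    using m(4)[of q] by (simp add: K_def algebra_simps)
  show thesis
  proof
    show "0 \<le> K q p" for q p using r01[of q] w_nonneg[of p] by (simp add: K_def)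
    show "(\<Sum>p\<in>B. K q p) = 1" for q
    proof -
      have "(\<Sum>p\<in>B. (if p = q then r q else 0)) = r q"
        using fin m_outside[of q] by (simp add: r_def)
      then show ?thesis
        using w_sum by (simp add: K_def sum.distrib flip: sum_distrib_left)
    qed
    show "(\<Sum>q\<in>A. \<mu> q * K q p) = \<nu> p" if "p \<in> B" for p
    proof -
      have "(\<Sum>q\<in>A. (if p = q then m q else 0)) = m p"
        using fin m_outside[of p] by simp
      then show ?thesis
        using surplus Dw[OF that] by (simp add: mass sum.distrib flip: sum_distrib_right)
    qed
    have "(\<Sum>q\<in>A. \<mu> q * (\<Sum>p\<in>B. K q p * of_bool (p \<noteq> q)))
        = (\<Sum>q\<in>A. \<Sum>p\<in>B. (\<mu> q * K q p) * of_bool (p \<noteq> q))"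
      by (simp add: sum_distrib_left mult.assoc)
    also have "\<dots> \<le> (\<Sum>q\<in>A. \<Sum>p\<in>B. (\<mu> q - m q) * w p)"
      using m w_nonneg by (intro sum_mono) (simp add: mass)
    also have "\<dots> = D"
      using w_sum surplus by (simp flip: sum_distrib_left)
    finally show "(\<Sum>q\<in>A. \<mu> q * (\<Sum>p\<in>B. K q p * of_bool (p \<noteq> q))) \<le> (\<Sum>p\<in>B. max 0 (\<nu> p - \<mu> p))"
      by (simp add: D_def)
  qed
qed


section \<open>Chaining the couplings along the time horizon\<close>

lemma sum_PiE_insert:
  fixes f :: "('i \<Rightarrow> 'p) \<Rightarrow> real"
  assumes "i \<notin> J"
  shows "sum f (Pi\<^sub>E (insert i J) P) = (\<Sum>s\<in>Pi\<^sub>E J P. \<Sum>p\<in>P i. f (s(i := p)))"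
proof -
  have "sum f (Pi\<^sub>E (insert i J) P) = (\<Sum>(p, s)\<in>P i \<times> Pi\<^sub>E J P. f (s(i := p)))"
    unfolding PiE_insert_eq
    by (subst sum.reindex[OF inj_combinator[OF assms]]) (simp add: case_prod_beta comp_def)
  also have "\<dots> = (\<Sum>s\<in>Pi\<^sub>E J P. \<Sum>p\<in>P i. f (s(i := p)))"
    by (subst sum.swap) (simp add: sum.cartesian_product)
  finally show ?thesis .
qed

text \<open>
  Induction on the horizon: each history is extended by a further step drawn from the kernel of a
  maximal coupling. The marginal property is stated for arbitrary test functions \<open>g\<close>; this also lets
  the induction hypothesis evaluate the marginal of the new step and its expected number of changes,
  as both are integrals of a function of the last state alone.
\<close>

lemma markov_chain_weights:
  fixes P :: "nat \<Rightarrow> 'p set" and \<mu> :: "nat \<Rightarrow> 'p \<Rightarrow> real"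
  assumes "\<And>t. t \<le> n \<Longrightarrow> finite (P t)"
    and "\<And>t p. t \<le> n \<Longrightarrow> 0 \<le> \<mu> t p"
    and "\<And>t p. t \<le> n \<Longrightarrow> p \<notin> P t \<Longrightarrow> \<mu> t p = 0"
    and "\<And>t. t \<le> n \<Longrightarrow> sum (\<mu> t) (P t) = 1"
  shows "\<exists>x. (\<forall>s\<in>Pi\<^sub>E {0..n} P. 0 \<le> x s)
    \<and> (\<forall>t\<le>n. \<forall>g. (\<Sum>s\<in>Pi\<^sub>E {0..n} P. x s * g (s t)) = (\<Sum>p\<in>P t. \<mu> t p * g p))
    \<and> (\<Sum>s\<in>Pi\<^sub>E {0..n} P. x s * (\<Sum>t\<in>{1..n}. of_bool (s t \<noteq> s (t - 1))))
        \<le> (\<Sum>t\<in>{1..n}. \<Sum>p\<in>P t. max 0 (\<mu> t p - \<mu> (t - 1) p))"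
  using assms
proof (induction n)
  case 0
  show ?case
    using "0.prems"(2)
    by (intro exI[of _ "\<lambda>s. \<mu> 0 (s 0)"]) (simp add: sum_PiE_insert)
next
  case (Suc n)
  let ?S = "Pi\<^sub>E {0..n} P"
  let ?c = "\<lambda>s n. (\<Sum>t\<in>{1..n}. of_bool (s t \<noteq> s (t - 1))) :: real"
  obtain x where x_nonneg: "\<And>s. s \<in> ?S \<Longrightarrow> 0 \<le> x s"
    and x_marginal: "\<And>t g. t \<le> n \<Longrightarrow> (\<Sum>s\<in>?S. x s * g (s t)) = (\<Sum>p\<in>P t. \<mu> t p * g p)"
    and x_changes: "(\<Sum>s\<in>?S. x s * ?c s n)
        \<le> (\<Sum>t\<in>{1..n}. \<Sum>p\<in>P t. max 0 (\<mu> t p - \<mu> (t - 1) p))"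
    using Suc.IH[OF Suc.prems[OF le_SucI]] by blast
  obtain K where K_nonneg: "\<And>q p. 0 \<le> K q p"
    and K_total: "\<And>q. (\<Sum>p\<in>P (Suc n). K q p) = 1"
    and K_marginal: "\<And>p. p \<in> P (Suc n) \<Longrightarrow> (\<Sum>q\<in>P n. \<mu> n q * K q p) = \<mu> (Suc n) p"
    and K_moves: "(\<Sum>q\<in>P n. \<mu> n q * (\<Sum>p\<in>P (Suc n). K q p * of_bool (p \<noteq> q)))
        \<le> (\<Sum>p\<in>P (Suc n). max 0 (\<mu> (Suc n) p - \<mu> n p))"
    by (rule maximal_coupling_kernel[of "P n" "P (Suc n)" "\<mu> n" "\<mu> (Suc n)"])
      (use Suc.prems in auto)
  define y where "y s = x (restrict s {0..n}) * K (s n) (s (Suc n))" for s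
  have y_upd: "y (s(Suc n := p)) = x s * K (s n) p" if "s \<in> ?S" for s p
  proof -
    have "restrict (s(Suc n := p)) {0..n} = s"
      using that by (auto simp: fun_eq_iff PiE_def extensional_def restrict_def)
    then show ?thesis by (simp add: y_def)
  qed
  have y_sum: "(\<Sum>s\<in>Pi\<^sub>E {0..Suc n} P. y s * h s)
      = (\<Sum>s\<in>?S. x s * (\<Sum>p\<in>P (Suc n). K (s n) p * h (s(Suc n := p))))" for h
    unfolding atLeast0_atMost_Suc
    by (subst sum_PiE_insert) (auto simp: y_upd sum_distrib_left mult.assoc intro!: sum.cong)
  have "0 \<le> y s" if "s \<in> Pi\<^sub>E {0..Suc n} P" for s
  proof -
    have "restrict s {0..n} \<in> ?S" using that by (auto simp: PiE_iff)
    then show ?thesis using x_nonneg K_nonneg by (simp add: y_def)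
  qed
  moreover have "(\<Sum>s\<in>Pi\<^sub>E {0..Suc n} P. y s * g (s t)) = (\<Sum>p\<in>P t. \<mu> t p * g p)"
    if "t \<le> Suc n" for t g
  proof (cases "t = Suc n")
    case True
    have "(\<Sum>s\<in>Pi\<^sub>E {0..Suc n} P. y s * g (s t))
        = (\<Sum>s\<in>?S. x s * (\<Sum>p\<in>P (Suc n). K (s n) p * g p))"
      using y_sum[of "\<lambda>s. g (s t)"] True by simp
    also have "\<dots> = (\<Sum>q\<in>P n. \<mu> n q * (\<Sum>p\<in>P (Suc n). K q p * g p))"
      using x_marginal[of n "\<lambda>q. \<Sum>p\<in>P (Suc n). K q p * g p"] by simp
    also have "\<dots> = (\<Sum>p\<in>P (Suc n). (\<Sum>q\<in>P n. \<mu> n q * K q p) * g p)"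
      unfolding sum_distrib_left sum_distrib_right mult.assoc by (rule sum.swap)
    also have "\<dots> = (\<Sum>p\<in>P t. \<mu> t p * g p)"
      using True K_marginal by simp
    finally show ?thesis .
  next
    case False
    then have "(\<Sum>s\<in>Pi\<^sub>E {0..Suc n} P. y s * g (s t))
        = (\<Sum>s\<in>?S. x s * ((\<Sum>p\<in>P (Suc n). K (s n) p) * g (s t)))"
      using y_sum[of "\<lambda>s. g (s t)"] by (simp add: sum_distrib_right)
    then show ?thesis using K_total x_marginal False that by simp
  qed
  moreover have "(\<Sum>s\<in>Pi\<^sub>E {0..Suc n} P. y s * ?c s (Suc n))
      \<le> (\<Sum>t\<in>{1..Suc n}. \<Sum>p\<in>P t. max 0 (\<mu> t p - \<mu> (t - 1) p))"
  proof -
    have c_upd: "?c (s(Suc n := p)) (Suc n) = ?c s n + of_bool (p \<noteq> s n)" for s p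
    proof -
      have "?c (s(Suc n := p)) n = ?c s n"
        by (rule sum.cong) auto
      then show ?thesis by simp
    qed
    have "(\<Sum>s\<in>Pi\<^sub>E {0..Suc n} P. y s * ?c s (Suc n))
        = (\<Sum>s\<in>?S. x s * (\<Sum>p\<in>P (Suc n). K (s n) p * (?c s n + of_bool (p \<noteq> s n))))"
      unfolding y_sum c_upd ..
    also have "\<dots> = (\<Sum>s\<in>?S. x s * ?c s n)
        + (\<Sum>s\<in>?S. x s * (\<Sum>p\<in>P (Suc n). K (s n) p * of_bool (p \<noteq> s n)))"
      unfolding distrib_left sum.distrib sum_distrib_right[symmetric] K_total mult_1 ..
    also have "(\<Sum>s\<in>?S. x s * (\<Sum>p\<in>P (Suc n). K (s n) p * of_bool (p \<noteq> s n)))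
        = (\<Sum>q\<in>P n. \<mu> n q * (\<Sum>p\<in>P (Suc n). K q p * of_bool (p \<noteq> q)))"
      using x_marginal[of n "\<lambda>q. \<Sum>p\<in>P (Suc n). K q p * of_bool (p \<noteq> q)"] by simp
    finally show ?thesis using x_changes K_moves by simp
  qed
  ultimately show ?case by blast
qed


section \<open>The two formulations\<close>

lemma finite_paths:
  assumes "valid_instance I" "t \<in> time_steps I"
  shows "finite (paths I k t)"
proof (cases "t = 0")
  case False
  interpret N: fin_digraph "network I"
    using assms by (simp add: valid_instance_def)
  have arcs: "arcs_at I t \<subseteq> arcs (network I)"
    using assms by (auto simp: valid_instance_def)
  have "finite (arcs_at I t \<times> (UNIV :: bool set))"
    using arcs finite_subset[OF _ N.finite_arcs] by simp
  then have "finite {(e, r). e \<in> arcs_at I t \<and> (is_directed I \<longrightarrow> \<not> r)}"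
    by (rule rev_finite_subset) auto
  then interpret T: fin_digraph "traversals I (arcs_at I t)"
    using arcs N.wellformed by unfold_locales (auto simp: traversals_def split: if_splits)
  have "paths I k t \<subseteq>
      Pair (origin I k t) ` {p. T.apath (origin I k t) p (destination I k t)}"
    using False by (auto simp: paths_def simple_flow_path_def image_iff prod_eq_iff)
  then show ?thesis
    using T.apaths_finite finite_subset by blast
qed (simp add: paths_def)

lemma finite_path_sequences:
  assumes "valid_instance I"
  shows "finite (path_sequences I k)"
  using finite_paths[OF assms] by (auto simp: path_sequences_def time_steps_def intro!: finite_PiE)

lemma path_sequence_at:
  assumes "s \<in> path_sequences I k" "t \<in> time_steps I"
  shows "s t \<in> paths I k t"
  using assms by (auto simp: path_sequences_def)

lemma path_changes_eq_sum:
  "real (path_changes I s) = (\<Sum>t\<in>{1..horizon I}. of_bool (s t \<noteq> s (t - 1)))"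
proof -
  have "{t \<in> time_steps I - {0}. s t \<noteq> s (t - 1)} = {1..horizon I} \<inter> {t. s t \<noteq> s (t - 1)}"
    by (auto simp: time_steps_def)
  then show ?thesis by (simp add: path_changes_def)
qed

lemma sum_by_path:
  fixes f :: "(nat \<Rightarrow> ('v, 'e) path) \<Rightarrow> real"
  assumes "valid_instance I" "t \<in> time_steps I"
  shows "(\<Sum>p\<in>{p \<in> paths I k t. Q p}. \<Sum>s\<in>{s \<in> path_sequences I k. s t = p}. f s)
    = (\<Sum>s\<in>{s \<in> path_sequences I k. Q (s t)}. f s)"
proof -
  have "(\<Sum>s\<in>{s \<in> path_sequences I k. Q (s t)}. f s)
      = (\<Sum>p\<in>{p \<in> paths I k t. Q p}. \<Sum>s\<in>{s \<in> {s \<in> path_sequences I k. Q (s t)}. s t = p}. f s)"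
    using assms finite_paths finite_path_sequences path_sequence_at
    by (intro sum.group[symmetric]) fastforce+
  also have "\<dots> = (\<Sum>p\<in>{p \<in> paths I k t. Q p}. \<Sum>s\<in>{s \<in> path_sequences I k. s t = p}. f s)"
    by (intro sum.cong) auto
  finally show ?thesis ..
qed

text \<open>
  The arc-path variables are the marginals, and \<open>n\<close> charges to \<open>p\<close> at time \<open>t\<close> exactly the sequences
  that arrive at \<open>p\<close> from another path, so each sequence is charged once per change.
\<close>

lemma ap_solution_of_ps_solution:
  fixes I :: "('v, 'e, 'k) flow_instance"
  assumes valid: "valid_instance I" and feasible: "ps_feasible I {0..1} x oe ot"
  obtains y n where "ap_feasible I {0..1} y n oe ot"
    and "ap_objective I n ot = ps_objective I x ot"
proof -
  let ?S = "path_sequences I"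
  define y where "y k p t = (\<Sum>s\<in>{s \<in> ?S k. s t = p}. x k s)" for k p t
  \<comment> \<open>Nothing is charged at time 0; there \<open>t - 1\<close> would be \<open>t\<close> itself.\<close>
  define n where "n k p t = (\<Sum>s\<in>{s \<in> ?S k. s t = p}. x k s * of_bool (s t \<noteq> s (t - 1)))" for k p t
  note fin = finite_path_sequences[OF valid]
  have x_total: "(\<Sum>s\<in>?S k. x k s) = 1" if "k \<in> commodities I" for k
    using feasible that by (simp add: ps_feasible_def)
  have x_nonneg: "0 \<le> x k s" if "k \<in> commodities I" "s \<in> ?S k" for k s
    using feasible that by (auto simp: ps_feasible_def)
  have y_total: "(\<Sum>p\<in>paths I k t. y k p t) = 1" if "k \<in> commodities I" "t \<in> time_steps I" for k t
    using sum_by_path[OF valid that(2), where k = k and Q = "\<lambda>_. True" and f = "x k"] x_total that by (simp add: y_def)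
  have y_range: "y k p t \<in> {0..1}" if "k \<in> commodities I" for k p t
  proof -
    have "y k p t \<le> (\<Sum>s\<in>?S k. x k s)"
      unfolding y_def using fin x_nonneg that by (intro sum_mono2) auto
    then show ?thesis using x_total x_nonneg that by (auto simp: y_def intro!: sum_nonneg)
  qed
  have y_outside: "y k p t = 0" if "t \<in> time_steps I" "p \<notin> paths I k t" for k p t
  proof -
    have "{s \<in> ?S k. s t = p} = {}"
      using that by (auto dest: path_sequence_at)
    then show ?thesis unfolding y_def by (metis sum.empty)
  qed
  have n_nonneg: "0 \<le> n k p t" if "k \<in> commodities I" for k p t
    using x_nonneg that by (auto simp: n_def intro!: sum_nonneg)
  have y_diff: "y k p t - y k p (t - 1) \<le> n k p t" if "k \<in> commodities I" for k p t
  proof -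
    let ?x = "\<lambda>Q. \<Sum>s\<in>?S k. x k s * of_bool (Q s)"
    have y: "y k p u = ?x (\<lambda>s. s u = p)" for u
      unfolding y_def using fin
      by (intro sum.mono_neutral_cong_left) auto
    have n: "n k p t = ?x (\<lambda>s. s t = p \<and> s (t - 1) \<noteq> p)"
      unfolding n_def using fin
      by (intro sum.mono_neutral_cong_left) auto
    show ?thesis
      unfolding y n sum_subtractf[symmetric]
      using x_nonneg that by (intro sum_mono) auto
  qed
  have load: "(\<Sum>p\<in>{p \<in> paths I k t. e \<in> path_arcs p}. y k p t * demand I k)
      = (\<Sum>s\<in>{s \<in> ?S k. e \<in> path_arcs (s t)}. x k s * demand I k)" if "t \<in> time_steps I" for k t e
    using sum_by_path[OF valid that, where k = k and Q = "\<lambda>p. e \<in> path_arcs p" and f = "x k"]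
    by (simp add: y_def flip: sum_distrib_right)
  have "ap_feasible I {0..1} y n oe ot"
    using feasible y_total y_range y_outside n_nonneg y_diff load
    by (simp add: ap_feasible_def ps_feasible_def)
  moreover have "(\<Sum>t\<in>time_steps I. \<Sum>p\<in>paths I k t. n k p t)
      = (\<Sum>s\<in>?S k. real (path_changes I s) * x k s)" for k
  proof -
    have "(\<Sum>t\<in>time_steps I. \<Sum>p\<in>paths I k t. n k p t)
        = (\<Sum>t\<in>time_steps I. \<Sum>s\<in>?S k. x k s * of_bool (s t \<noteq> s (t - 1)))"
    proof (rule sum.cong[OF refl])
      fix t assume "t \<in> time_steps I"
      from sum_by_path[OF valid this, where k = k and Q = "\<lambda>_. True"
          and f = "\<lambda>s. x k s * of_bool (s t \<noteq> s (t - 1))"]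
      show "(\<Sum>p\<in>paths I k t. n k p t) = (\<Sum>s\<in>?S k. x k s * of_bool (s t \<noteq> s (t - 1)))"
        by (simp add: n_def)
    qed
    also have "\<dots> = (\<Sum>t\<in>{1..horizon I}. \<Sum>s\<in>?S k. x k s * of_bool (s t \<noteq> s (t - 1)))"
    proof (rule sum.mono_neutral_right)
      show "\<forall>t\<in>time_steps I - {1..horizon I}.
          (\<Sum>s\<in>?S k. x k s * of_bool (s t \<noteq> s (t - 1))) = 0"
      proof
        fix t assume "t \<in> time_steps I - {1..horizon I}"
        then have "t = 0" by (auto simp: time_steps_def)
        then show "(\<Sum>s\<in>?S k. x k s * of_bool (s t \<noteq> s (t - 1))) = 0" by simp
      qed
    qed (auto simp: time_steps_def)
    also have "\<dots> = (\<Sum>s\<in>?S k. real (path_changes I s) * x k s)"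
      unfolding path_changes_eq_sum sum_distrib_right
      by (subst sum.swap) (simp add: mult.commute)
    finally show ?thesis .
  qed
  then have "ap_objective I n ot = ps_objective I x ot"
    by (simp add: ap_objective_def ps_objective_def)
  ultimately show thesis by (rule that)
qed

text \<open>
  The chain of maximal couplings is built for each commodity separately; the commodities interact
  only through the arc loads, which depend on the marginals alone.
\<close>

lemma ps_solution_of_ap_solution:
  fixes I :: "('v, 'e, 'k) flow_instance"
  assumes valid: "valid_instance I" and feasible: "ap_feasible I {0..1} x n oe ot"
  obtains y where "ps_feasible I {0..1} y oe ot"
    and "ps_objective I y ot \<le> ap_objective I n ot"
proof -
  let ?S = "path_sequences I"
  let ?\<Delta> = "\<lambda>k. \<Sum>t\<in>{1..horizon I}. \<Sum>p\<in>paths I k t. max 0 (x k p t - x k p (t - 1))"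
  have fin: "finite (paths I k t)" if "t \<le> horizon I" for k t
    using finite_paths[OF valid] that by (simp add: time_steps_def)
  have x_total: "(\<Sum>p\<in>paths I k t. x k p t) = 1"
    if "k \<in> commodities I" "t \<le> horizon I" for k t
    using feasible that by (simp add: ap_feasible_def time_steps_def)
  have x_outside: "x k p t = 0"
    if "k \<in> commodities I" "t \<le> horizon I" "p \<notin> paths I k t" for k p t
    using feasible that by (simp add: ap_feasible_def time_steps_def del: split_paired_All)
  have x_nonneg: "0 \<le> x k p t" if "k \<in> commodities I" "t \<le> horizon I" for k p t
  proof (cases "p \<in> paths I k t")
    case True
    then show ?thesis using feasible that by (simp add: ap_feasible_def time_steps_def)
  qed (simp add: x_outside that)
  let ?good = "\<lambda>k y. (\<forall>s\<in>?S k. 0 \<le> y s)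
      \<and> (\<forall>t\<le>horizon I. \<forall>g. (\<Sum>s\<in>?S k. y s * g (s t)) = (\<Sum>p\<in>paths I k t. x k p t * g p))
      \<and> (\<Sum>s\<in>?S k. y s * real (path_changes I s)) \<le> ?\<Delta> k"
  have "\<exists>y. ?good k y" if "k \<in> commodities I" for k
    unfolding path_sequences_def time_steps_def path_changes_eq_sum
    by (rule markov_chain_weights[of "horizon I" "paths I k" "\<lambda>t p. x k p t"])
      (simp_all add: fin x_total[OF that] x_outside[OF that] x_nonneg[OF that])
  then obtain y where good: "\<forall>k\<in>commodities I. ?good k (y k)"
    using bchoice[of "commodities I" ?good] by blast
  have y_nonneg: "0 \<le> y k s" if "k \<in> commodities I" "s \<in> ?S k" for k s
    using good that by blast
  have y_marginal: "(\<Sum>s\<in>?S k. y k s * g (s t)) = (\<Sum>p\<in>paths I k t. x k p t * g p)"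
    if "k \<in> commodities I" "t \<le> horizon I" for k t g
    using good that by blast
  have y_changes: "(\<Sum>s\<in>?S k. y k s * real (path_changes I s)) \<le> ?\<Delta> k"
    if "k \<in> commodities I" for k
    using good that by blast
  have y_total: "(\<Sum>s\<in>?S k. y k s) = 1" if "k \<in> commodities I" for k
    using y_marginal[OF that, of 0 "\<lambda>_. 1"] x_total[OF that] by simp
  have y_le_1: "y k s \<le> 1" if "k \<in> commodities I" "s \<in> ?S k" for k s
    using member_le_sum[of s "?S k" "y k"] y_total y_nonneg that finite_path_sequences[OF valid]
    by simp
  have load: "(\<Sum>s\<in>{s \<in> ?S k. e \<in> path_arcs (s t)}. y k s * demand I k)
      = (\<Sum>p\<in>{p \<in> paths I k t. e \<in> path_arcs p}. x k p t * demand I k)"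
    if "k \<in> commodities I" "t \<in> time_steps I" for k t e
  proof -
    have "(\<Sum>s\<in>{s \<in> ?S k. e \<in> path_arcs (s t)}. y k s * demand I k)
        = (\<Sum>s\<in>?S k. y k s * (of_bool (e \<in> path_arcs (s t)) * demand I k))"
      using finite_path_sequences[OF valid] by (intro sum.mono_neutral_cong_left) auto
    also have "\<dots> = (\<Sum>p\<in>paths I k t. x k p t * (of_bool (e \<in> path_arcs p) * demand I k))"
      using that
      by (intro y_marginal[where g = "\<lambda>p. of_bool (e \<in> path_arcs p) * demand I k"])
        (auto simp: time_steps_def)
    also have "\<dots> = (\<Sum>p\<in>{p \<in> paths I k t. e \<in> path_arcs p}. x k p t * demand I k)"
      using finite_paths[OF valid that(2)] by (intro sum.mono_neutral_cong_right) auto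
    finally show ?thesis .
  qed
  have "ps_feasible I {0..1} y oe ot"
    using feasible y_total y_nonneg y_le_1 load by (simp add: ap_feasible_def ps_feasible_def)
  moreover have "ps_objective I y ot \<le> ap_objective I n ot"
  proof -
    have "(\<Sum>s\<in>?S k. real (path_changes I s) * y k s)
        \<le> (\<Sum>t\<in>time_steps I. \<Sum>p\<in>paths I k t. n k p t)" if k: "k \<in> commodities I" for k
    proof -
      have "(\<Sum>s\<in>?S k. real (path_changes I s) * y k s) \<le> ?\<Delta> k"
        using y_changes[OF k] by (simp add: mult.commute)
      also have "\<dots> \<le> (\<Sum>t\<in>{1..horizon I}. \<Sum>p\<in>paths I k t. n k p t)"
        using feasible k by (intro sum_mono) (auto simp: ap_feasible_def time_steps_def)
      also have "\<dots> \<le> (\<Sum>t\<in>time_steps I. \<Sum>p\<in>paths I k t. n k p t)"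
        using feasible k
        by (intro sum_mono2 sum_nonneg) (auto simp: ap_feasible_def time_steps_def)
      finally show ?thesis .
    qed
    moreover have "0 \<le> change_price I"
      using valid by (simp add: valid_instance_def)
    ultimately show ?thesis
      unfolding ps_objective_def ap_objective_def
      by (intro add_right_mono mult_left_mono sum_mono)
  qed
  ultimately show thesis by (rule that)
qed

theorem proposition1:
  fixes I :: "('v, 'e, 'k) flow_instance"
  assumes "valid_instance I"
  shows "ap_value I {0..1} = ps_value I {0..1}"
proof (rule antisym)
  show "ap_value I {0..1} \<le> ps_value I {0..1}"
    unfolding ap_value_def ps_value_def
  proof (rule Inf_mono)
    fix b assume "b \<in> {ereal (ps_objective I x ot) | x oe ot. ps_feasible I {0..1} x oe ot}"
    then obtain x oe ot where "ps_feasible I {0..1} x oe ot" "b = ereal (ps_objective I x ot)"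
      by blast
    moreover from this(1) obtain y n where "ap_feasible I {0..1} y n oe ot"
      and "ap_objective I n ot = ps_objective I x ot"
      by (rule ap_solution_of_ps_solution[OF assms])
    ultimately have "ap_feasible I {0..1} y n oe ot" "ereal (ap_objective I n ot) \<le> b"
      by simp_all
    then show "\<exists>a\<in>{ereal (ap_objective I n ot) | x n oe ot. ap_feasible I {0..1} x n oe ot}. a \<le> b"
      by blast
  qed
  show "ps_value I {0..1} \<le> ap_value I {0..1}"
    unfolding ap_value_def ps_value_def
  proof (rule Inf_mono)
    fix b assume "b \<in> {ereal (ap_objective I n ot) | x n oe ot. ap_feasible I {0..1} x n oe ot}"
    then obtain x n oe ot where "ap_feasible I {0..1} x n oe ot" "b = ereal (ap_objective I n ot)"
      by blast
    then obtain y where "ps_feasible I {0..1} y oe ot" "ereal (ps_objective I y ot) \<le> b"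
      using ps_solution_of_ap_solution[OF assms] by (metis ereal_less_eq(3))
    then show "\<exists>a\<in>{ereal (ps_objective I x ot) | x oe ot. ps_feasible I {0..1} x oe ot}. a \<le> b"
      by blast
  qed
qed

end
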